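(* Let $\mathbf{k}$ be a field of characteristic zero, let $L$ be the two-dimensional Lie algebra over $\mathbf{k}$ with basis $W,D$ and bracket $[W,D]=2D$, and let $A$ be a commutative associative $\mathbf{k}$-algebra that is an $L$-module on which $L$ acts by derivations of the product. Then for every integer $n\ge 1$, the generalized Rankin--Cohen bracket $[-,-]_n$ on $A$ satisfies the standard identity of degree $d=\frac{9n(n+1)}{2}-1$, that is, $$s_{d,l}^{[-,-]_n}(a_1,\ldots,a_d)=s_{d,r}^{[-,-]_n}(a_1,\ldots,a_d)=0$$ for all $a_1,\ldots,a_d\in A$.
   Context: Generalized Rankin--Cohen bracket: for $a,b\in A$, $$[a,b]_n:=\sum_{r+s=n}(-1)^r\, D^r\binom{W+n-1}{s}(a)\cdot D^s\binom{W+n-1}{r}(b),$$ where the sum is over integers $r,s\ge 0$ with $r+s=n$, and for $k\ge 0$ the expression $\binom{W+n-1}{k}$ denotes the result of substituting $W+n-1$ (where $n-1$ stands for $(n-1)$ times the identity) for $z$ in the polynomial $\binom{z}{k}=\frac{z(z-1)\cdots(z-k+1)}{k!}$. Thus $D^r\binom{W+n-1}{s}(a)$ means: first apply the operator $\binom{W+n-1}{s}$ to $a$, then apply $D^r$. Standard polynomials: for a bilinear operation $\{-,-\}$ on $A$, $$s_{d,l}^{\{-,-\}}(a_1,\ldots,a_d):=\sum_{\sigma\in S_{d-1}}(-1)^{\sigma}\{a_{\sigma(1)},\{a_{\sigma(2)},\{\ldots,\{a_{\sigma(d-2)},\{a_{\sigma(d-1)},a_d\}\}\ldots\}\}\},$$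 $$s_{d,r}^{\{-,-\}}(a_1,\ldots,a_d):=\sum_{\sigma\in S_{d-1}}(-1)^{\sigma}\{\{\{\ldots\{\{a_d,a_{\sigma(d-1)}\},a_{\sigma(d-2)}\},\ldots\},a_{\sigma(2)}\},a_{\sigma(1)}\},$$ where $(-1)^\sigma$ is the sign of the permutation $\sigma$. *)

theory Defs
  imports
    "HOL-Computational_Algebra.Polynomial"
    "HOL-Combinatorics.Permutations"
begin

locale lie_algebra = vector_space scaleL
  for scaleL :: "'k::field \<Rightarrow> 'l::ab_group_add \<Rightarrow> 'l" +
  fixes lbr :: "'l \<Rightarrow> 'l \<Rightarrow> 'l"
  assumes lbr_linear_right: "Vector_Spaces.linear scaleL scaleL (lbr x)"
    and lbr_linear_left: "Vector_Spaces.linear scaleL scaleL (\<lambda>x. lbr x y)"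
    and lbr_self: "lbr x x = 0"
    and jacobi: "lbr x (lbr y z) + lbr y (lbr z x) + lbr z (lbr x y) = 0"

locale two_dim_lie_algebra = lie_algebra scaleL lbr
  for scaleL :: "'k::field \<Rightarrow> 'l::ab_group_add \<Rightarrow> 'l" and lbr +
  fixes W D :: 'l
  assumes W_neq_D: "W \<noteq> D"
    and basis_independent: "independent {W, D}"
    and basis_span: "span {W, D} = UNIV"
    and lbr_W_D: "lbr W D = scaleL 2 D"

text \<open>The class \<^class>\<open>comm_ring\<close> does not require a unit, so algebras need not be unital.\<close>

locale comm_assoc_algebra = vector_space scaleA
  for scaleA :: "'k::field \<Rightarrow> 'a::comm_ring \<Rightarrow> 'a" +
  assumes scale_mult: "scaleA c (a * b) = scaleA c a * b"

locale lie_module = L: lie_algebra scaleL lbr + M: vector_space scaleM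
  for scaleL :: "'k::field \<Rightarrow> 'l::ab_group_add \<Rightarrow> 'l" and lbr
    and scaleM :: "'k \<Rightarrow> 'm::ab_group_add \<Rightarrow> 'm" +
  fixes act :: "'l \<Rightarrow> 'm \<Rightarrow> 'm"
  assumes act_linear: "Vector_Spaces.linear scaleM scaleM (act x)"
    and act_linear_left: "Vector_Spaces.linear scaleL scaleM (\<lambda>x. act x v)"
    and act_lbr: "act (lbr x y) v = act x (act y v) - act y (act x v)"

locale lie_module_algebra =
  lie_module scaleL lbr scaleA act + A: comm_assoc_algebra scaleA
  for scaleL :: "'k::field \<Rightarrow> 'l::ab_group_add \<Rightarrow> 'l" and lbr
    and scaleA :: "'k \<Rightarrow> 'a::comm_ring \<Rightarrow> 'a" and act +
  assumes act_derivation: "act x (a * b) = act x a * b + a * act x b"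

definition binom_poly :: "nat \<Rightarrow> 'k::field_char_0 poly" where
  "binom_poly k = smult (1 / fact k) (\<Prod>i<k. [:- of_nat i, 1:])"

text \<open>Substitution of a linear operator \<open>T\<close> into a polynomial.\<close>

definition poly_op ::
  "('k::field \<Rightarrow> 'a::ab_group_add \<Rightarrow> 'a) \<Rightarrow> 'k poly \<Rightarrow> ('a \<Rightarrow> 'a) \<Rightarrow> 'a \<Rightarrow> 'a" where
  "poly_op scale p T a = (\<Sum>i\<le>degree p. scale (coeff p i) ((T ^^ i) a))"

definition shift_op ::
  "('k::field \<Rightarrow> 'a::ab_group_add \<Rightarrow> 'a) \<Rightarrow> ('a \<Rightarrow> 'a) \<Rightarrow> nat \<Rightarrow> 'a \<Rightarrow> 'a" where
  "shift_op scale W n a = W a + scale (of_nat n - 1) a"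

definition rc_bracket ::
  "('k::field_char_0 \<Rightarrow> 'a::comm_ring \<Rightarrow> 'a) \<Rightarrow> ('a \<Rightarrow> 'a) \<Rightarrow> ('a \<Rightarrow> 'a) \<Rightarrow> nat \<Rightarrow> 'a \<Rightarrow> 'a \<Rightarrow> 'a" where
  "rc_bracket scale W D n a b =
    (\<Sum>(r, s) \<in> {(r, s). r + s = n}.
      scale ((-1) ^ r)
        ((D ^^ r) (poly_op scale (binom_poly s) (shift_op scale W n) a) *
         (D ^^ s) (poly_op scale (binom_poly r) (shift_op scale W n) b)))"

text \<open>The arguments \<open>a\<^sub>1, \<dots>, a\<^sub>d\<close> are the values \<open>a 1, \<dots>, a d\<close> of \<open>a :: nat \<Rightarrow> 'a\<close>;
  in both folds the index \<open>1\<close> belongs to the outermost operation.\<close>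

definition std_left ::
  "('k::field \<Rightarrow> 'a::ab_group_add \<Rightarrow> 'a) \<Rightarrow> ('a \<Rightarrow> 'a \<Rightarrow> 'a) \<Rightarrow> nat \<Rightarrow> (nat \<Rightarrow> 'a) \<Rightarrow> 'a" where
  "std_left scale br d a =
    (\<Sum>\<sigma> | \<sigma> permutes {1..d - 1}.
      scale (of_int (sign \<sigma>)) (foldr (\<lambda>i x. br (a (\<sigma> i)) x) [1..<d] (a d)))"

definition std_right ::
  "('k::field \<Rightarrow> 'a::ab_group_add \<Rightarrow> 'a) \<Rightarrow> ('a \<Rightarrow> 'a \<Rightarrow> 'a) \<Rightarrow> nat \<Rightarrow> (nat \<Rightarrow> 'a) \<Rightarrow> 'a" where
  "std_right scale br d a =
    (\<Sum>\<sigma> | \<sigma> permutes {1..d - 1}.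
      scale (of_int (sign \<sigma>)) (foldr (\<lambda>i x. br x (a (\<sigma> i))) [1..<d] (a d)))"

end

theory Submission
  imports Defs
begin

text \<open>
  Put \<open>u\<^sub>(\<^sub>i\<^sub>,\<^sub>j\<^sub>) = D\<^sup>i W\<^sup>j\<close>, of order \<open>i + j\<close>. Both constant terms of the bracket vanish, because
  \<open>binom (n-1) n = 0\<close>; hence it is a combination of products \<open>u\<^sub>p x \<cdot> u\<^sub>q y\<close> with \<open>p, q\<close> nonzero of
  order at most \<open>n\<close>. By the Leibniz rule an iterated bracket is a combination of monomials in the
  \<open>u\<^sub>p a\<^sub>i\<close>, all \<open>p\<close> nonzero, of total order at most \<open>2n(d-1)\<close>. Alternation kills each monomial in
  which two of \<open>a\<^sub>1, \<dots>, a\<^sub>d\<^sub>-\<^sub>1\<close> carry the same \<open>p\<close>. But \<open>d - 1 = (3n+1)(3n+2)/2 - 3\<close> distinct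
  nonzero \<open>p\<close> have total order at least \<open>2n(d-1)\<close>, which leaves nothing for \<open>a\<^sub>d\<close>.
\<close>

section \<open>Counting exponents\<close>

definition deg :: "nat \<times> nat \<Rightarrow> nat" where
  "deg p = fst p + snd p"

lemma finite_deg_le: "finite {p. deg p \<le> m}"
  by (rule finite_subset[of _ "{..m} \<times> {..m}"]) (auto simp: deg_def)

text \<open>Exactly k + 1 exponents have order k.\<close>

lemma sum_deg_le:
  fixes g :: "nat \<Rightarrow> int"
  shows "(\<Sum>p | deg p \<le> m. g (deg p)) = (\<Sum>k\<le>m. (int k + 1) * g k)"
proof -
  have "(\<Sum>p | deg p \<le> m. g (deg p)) = (\<Sum>(i, j) \<in> {(i, j). i + j \<le> m}. g (i + j))"
    by (rule sum.cong) (auto simp: deg_def)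
  also have "\<dots> = (\<Sum>k\<le>m. \<Sum>i\<le>k. g (i + (k - i)))"
    by (rule sum.triangle_reindex_eq)
  also have "\<dots> = (\<Sum>k\<le>m. (int k + 1) * g k)"
    by (rule sum.cong) auto
  finally show ?thesis .
qed

text \<open>Needed at m = c = 3n, where the last factor becomes -3n.\<close>

lemma sum_excess:
  fixes c :: int
  shows "6 * (\<Sum>k\<le>m. (int k + 1) * (int k - c)) =
    (int m + 1) * (int m + 2) * (2 * int m - 3 * c)"
  by (induction m) (auto simp: algebra_simps)

text \<open>Among sets of nonzero exponents, the excess \<open>\<Sum>(deg p - 3n)\<close> is smallest for the set of all
  nonzero exponents of order at most \<open>3n\<close>, where it can be computed.\<close>

lemma sum_deg_ge:
  assumes "finite P" and pos: "\<And>p. p \<in> P \<Longrightarrow> 0 < deg p"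
    and card: "2 * card P + 4 = 9 * n * (n + 1)"
  shows "2 * n * card P \<le> (\<Sum>p\<in>P. deg p)"
proof -
  define h where "h p = int (deg p) - 3 * int n" for p
  define T where "T = {p. deg p \<le> 3 * n}"
  have fT: "finite T"
    unfolding T_def by (rule finite_deg_le)
  have "6 * sum h T = - 3 * int n * (3 * int n + 1) * (3 * int n + 2)"
    using sum_deg_le[of "\<lambda>k. int k - 3 * int n" "3 * n"] sum_excess[where m = "3 * n" and c = "3 * int n"]
    unfolding h_def T_def by (simp add: algebra_simps)
  \<comment> \<open>The zero exponent, of excess -3n, is split off because \<open>P\<close> avoids
    it.\<close>
  moreover have "sum h T = h (0, 0) + sum h (T - {(0, 0)})"
    using fT by (intro sum.remove) (auto simp: T_def deg_def)
  ultimately have T: "2 * sum h (T - {(0, 0)}) = 6 * int n - int n * (3 * int n + 1) * (3 * int n + 2)"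
    by (simp add: h_def deg_def)
  \<comment> \<open>Exchange argument: passing from the nonzero part of \<open>T\<close> to
    \<open>P\<close> drops terms with \<open>h\<close> at most 0 and gains terms with
    \<open>h\<close> positive.\<close>
  have "sum h (T - {(0, 0)}) = sum h (P \<inter> T) + sum h (T - {(0, 0)} - P)"
    using fT pos[of "(0, 0)"] by (subst sum.union_disjoint[symmetric])
      (auto simp: deg_def intro!: sum.cong)
  also have "sum h (T - {(0, 0)} - P) \<le> 0"
    by (rule sum_nonpos) (auto simp: h_def T_def)
  also have "sum h (P \<inter> T) + 0 \<le> sum h (P \<inter> T) + sum h (P - T)"
    by (intro add_left_mono sum_nonneg) (auto simp: h_def T_def)
  also have "\<dots> = sum h P"
    using \<open>finite P\<close> by (subst sum.union_disjoint[symmetric]) (auto intro!: sum.cong)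
  also have "\<dots> = int (\<Sum>p\<in>P. deg p) - 3 * int n * int (card P)"
    by (simp add: h_def sum_subtractf)
  finally have "2 * int (\<Sum>p\<in>P. deg p) \<ge>
      6 * int n * int (card P) + 6 * int n - int n * (3 * int n + 1) * (3 * int n + 2)"
    using T by linarith
  \<comment> \<open>Since (3n+1)(3n+2) = 2 card P + 6, the lower bound just obtained equals 4n card
    P. Having two elements fewer than the nonzero part of \<open>T\<close> costs nothing: exponents
    of order 3n have excess 0.\<close>
  moreover have "2 * int (card P) = 9 * int n * (int n + 1) - 4"
    using arg_cong[OF card, of int] by (simp add: algebra_simps)
  then have "int n * (2 * int (card P)) = int n * (9 * int n * (int n + 1) - 4)"
    by simp
  ultimately have "2 * int (\<Sum>p\<in>P. deg p) \<ge> 4 * int n * int (card P)"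
    by (simp add: algebra_simps)
  then have "int (2 * n * card P) \<le> int (\<Sum>p\<in>P. deg p)"
    by simp
  then show ?thesis
    by linarith
qed

section \<open>Substituting operators into polynomials\<close>

lemma poly_binom_poly: "poly (binom_poly k) x = x gchoose k"
  by (simp add: binom_poly_def poly_prod gbinomial_prod_rev atLeast0LessThan)

lemma degree_binom_poly: "degree (binom_poly k) \<le> k"
proof -
  have "degree (\<Prod>i<k. [:- of_nat i, 1 :: 'a:]) \<le> (\<Sum>i<k. degree [:- of_nat i, 1 :: 'a:])"
    using degree_prod_sum_le[of "{..<k}" "\<lambda>i. [:- of_nat i, 1 :: 'a:]"] by (simp add: comp_def)
  then show ?thesis
    unfolding binom_poly_def using degree_smult_le order_trans by fastforce
qed

context vector_space
begin

lemma poly_op_eq_sum: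
  assumes "degree p \<le> m"
  shows "poly_op scale p T x = (\<Sum>i\<le>m. scale (coeff p i) ((T ^^ i) x))"
  unfolding poly_op_def
  by (rule sum.mono_neutral_left) (use assms in \<open>auto simp: coeff_eq_0\<close>)

lemma poly_op_add: "poly_op scale (p + q) T x = poly_op scale p T x + poly_op scale q T x"
proof -
  define m where "m = max (degree p) (degree q)"
  have "degree p \<le> m" "degree q \<le> m" "degree (p + q) \<le> m"
    by (auto simp: m_def degree_add_le)
  then show ?thesis
    by (simp add: poly_op_eq_sum[of _ m] scale_left_distrib sum.distrib)
qed

lemma poly_op_smult: "poly_op scale (smult c p) T x = scale c (poly_op scale p T x)"
proof -
  have "degree (smult c p) \<le> degree p"
    by simp
  then show ?thesis
    by (simp add: poly_op_eq_sum[of _ "degree p"] scale_sum_right)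
qed

text \<open>Horner's rule, which opens substitution to induction on the polynomial.\<close>

lemma poly_op_pCons:
  assumes "Vector_Spaces.linear scale scale T"
  shows "poly_op scale (pCons c p) T x = scale c x + T (poly_op scale p T x)"
proof -
  interpret T: Vector_Spaces.linear scale scale T
    by fact
  show ?thesis
    unfolding poly_op_eq_sum[OF degree_pCons_le] poly_op_def[of _ p] sum.atMost_Suc_shift
    by (simp add: T.sum T.scale)
qed

text \<open>Moves the shift by n - 1 from the operator into the polynomial, so that the coefficients
  of the powers of W itself become visible.\<close>

lemma poly_op_shift_op:
  assumes "Vector_Spaces.linear scale scale T"
  shows "poly_op scale p (shift_op scale T n) x =
    poly_op scale (pcompose p [:of_nat n - 1, 1:]) T x"
proof -
  interpret T: Vector_Spaces.linear scale scale T
    by fact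
  have lin: "Vector_Spaces.linear scale scale (shift_op scale T n)"
    by unfold_locales
      (auto simp: shift_op_def T.add T.scale scale_right_distrib scale_left_commute)
  show ?thesis
  proof (induction p)
    case 0
    then show ?case
      by (simp add: poly_op_def)
  next
    case (pCons c p)
    let ?y = "poly_op scale (pcompose p [:of_nat n - 1, 1:]) T x"
    have "poly_op scale (pCons c p) (shift_op scale T n) x = scale c x + shift_op scale T n ?y"
      by (simp only: poly_op_pCons[OF lin] pCons.IH)
    also have "\<dots> = scale c x + (T ?y + scale (of_nat n - 1) ?y)"
      by (simp only: shift_op_def)
    also have "\<dots> = poly_op scale (pcompose (pCons c p) [:of_nat n - 1, 1:]) T x"
      by (simp add: poly_op_pCons[OF assms] pcompose_pCons poly_op_add poly_op_smult
          poly_op_def[of _ 0] T.zero)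
    finally show ?case .
  qed
qed

end

section \<open>Monomials in derivatives\<close>

text \<open>The operators by which the Lie algebra acts; \<open>W_D\<close> states [W, D] = 2D as a
  rule for moving W past D.\<close>

locale rc_algebra = comm_assoc_algebra scaleA
  for scaleA :: "'k::field_char_0 \<Rightarrow> 'a::comm_ring \<Rightarrow> 'a" +
  fixes W D :: "'a \<Rightarrow> 'a"
  assumes linear_W: "Vector_Spaces.linear scaleA scaleA W"
    and linear_D: "Vector_Spaces.linear scaleA scaleA D"
    and W_mult: "W (x * y) = W x * y + x * W y"
    and D_mult: "D (x * y) = D x * y + x * D y"
    and W_D: "W (D x) = D (W x) + scaleA 2 (D x)"
begin

sublocale W: Vector_Spaces.linear scaleA scaleA W
  by (rule linear_W)

sublocale D: Vector_Spaces.linear scaleA scaleA D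
  by (rule linear_D)

lemma mult_scale_right: "x * scaleA c y = scaleA c (x * y)"
  by (metis mult.commute scale_mult)

lemma mult_scale_left: "scaleA c x * y = scaleA c (x * y)"
  by (simp add: scale_mult)

definition u :: "nat \<times> nat \<Rightarrow> 'a \<Rightarrow> 'a" where
  "u p x = (D ^^ fst p) ((W ^^ snd p) x)"

lemma D_u: "D (u p x) = u (Suc (fst p), snd p) x"
  by (simp add: u_def)

lemma W_D_power: "W ((D ^^ i) x) = (D ^^ i) (W x) + scaleA (2 * of_nat i) ((D ^^ i) x)"
  by (induction i) (auto simp: W_D D.add D.scale algebra_simps scale_left_distrib)

text \<open>Each power of D is an eigenvector of the commutator with W, so reordering only adds a
  multiple of the same \<open>u p\<close>. Both D and W thus raise the order of \<open>u p\<close>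
  by one, up to such a multiple.\<close>

lemma W_u: "W (u p x) = u (fst p, Suc (snd p)) x + scaleA (2 * of_nat (fst p)) (u p x)"
  by (simp add: u_def W_D_power)

text \<open>The algebra need not have a unit, so the product is a fold that starts from the factor of the
  distinguished argument \<open>b e\<close>, the innermost one of the iterated bracket.\<close>

definition monomial :: "nat \<Rightarrow> (nat \<Rightarrow> nat \<times> nat) \<Rightarrow> nat set \<Rightarrow> nat \<times> nat \<Rightarrow> (nat \<Rightarrow> 'a) \<Rightarrow> 'a" where
  "monomial e f S q b = Finite_Set.fold (\<lambda>i y. u (f i) (b i) * y) (u q (b e)) S"

lemma comp_fun_commute_mult: "comp_fun_commute (\<lambda>i y. g i * y)" for g :: "nat \<Rightarrow> 'a"
  by unfold_locales (auto simp: fun_eq_iff mult.left_commute)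

lemma monomial_empty: "monomial e f {} q b = u q (b e)"
  by (simp add: monomial_def)

lemma monomial_insert:
  assumes "finite S" "k \<notin> S"
  shows "monomial e f (insert k S) q b = u (f k) (b k) * monomial e f S q b"
  unfolding monomial_def
  by (rule comp_fun_commute_on.fold_insert[OF
        comp_fun_commute_mult[unfolded comp_fun_commute_def'] subset_UNIV assms])

lemma monomial_cong:
  assumes "finite S" "\<And>i. i \<in> S \<Longrightarrow> f i = g i"
  shows "monomial e f S q b = monomial e g S q b"
  using assms by (induction S rule: finite_induct) (auto simp: monomial_empty monomial_insert)

lemma mult_monomial:
  assumes "finite S" "k \<notin> S"
  shows "u p (b k) * monomial e f S q b = monomial e (f(k := p)) (insert k S) q b"
proof -
  have "monomial e f S q b = monomial e (f(k := p)) S q b"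
    using assms by (intro monomial_cong) auto
  then show ?thesis
    using assms by (simp add: monomial_insert)
qed

text \<open>The transposition preserves \<open>S\<close>, \<open>f\<close> and the point
  \<open>e\<close>, so it merely reorders commuting factors.\<close>

lemma monomial_transpose:
  assumes "i \<in> S" "j \<in> S" "e \<notin> S" "f i = f j"
  shows "monomial e f S q (b \<circ> transpose i j) = monomial e f S q b"
proof -
  let ?t = "transpose i j"
  have f: "f (?t k) = f k" for k
    using assms(4) by (auto simp: transpose_def)
  have e: "?t e = e"
    using assms by (auto simp: transpose_def)
  have S: "?t ` S = S"
    using assms(1,2) by simp
  have "monomial e f S q b = Finite_Set.fold (\<lambda>i y. u (f i) (b i) * y) (u q (b e)) (?t ` S)"
    by (simp only: S monomial_def)
  also have "\<dots> = Finite_Set.fold ((\<lambda>i y. u (f i) (b i) * y) \<circ> ?t) (u q (b e)) S"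
    by (rule fold_image) (rule inj_on_subset[OF inj_transpose subset_UNIV])
  also have "\<dots> = monomial e f S q (b \<circ> ?t)"
    by (simp add: monomial_def comp_def f e)
  finally show ?thesis
    by simp
qed

section \<open>Spans of monomials of bounded order\<close>

text \<open>The members are functions of the whole family \<open>b\<close>, so that the arguments
  can be permuted later. \<open>S\<close> indexes the alternating arguments, and \<open>m\<close>
  bounds the total order, including that of the factor at \<open>e\<close>.\<close>

inductive mspan :: "nat \<Rightarrow> nat set \<Rightarrow> nat \<Rightarrow> ((nat \<Rightarrow> 'a) \<Rightarrow> 'a) \<Rightarrow> bool"
  for e S m where
    mspan_zero: "mspan e S m (\<lambda>b. 0)"
  | mspan_monomial: "(\<And>i. i \<in> S \<Longrightarrow> 0 < deg (f i)) \<Longrightarrow> 0 < deg q \<Longrightarrow>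
      (\<Sum>i\<in>S. deg (f i)) + deg q \<le> m \<Longrightarrow> mspan e S m (\<lambda>b. monomial e f S q b)"
  | mspan_add: "mspan e S m \<Phi> \<Longrightarrow> mspan e S m \<Psi> \<Longrightarrow> mspan e S m (\<lambda>b. \<Phi> b + \<Psi> b)"
  | mspan_scale: "mspan e S m \<Phi> \<Longrightarrow> mspan e S m (\<lambda>b. scaleA c (\<Phi> b))"

lemma mspan_le: "mspan e S m \<Phi> \<Longrightarrow> m \<le> m' \<Longrightarrow> mspan e S m' \<Phi>"
  by (induction rule: mspan.induct) (auto intro: mspan.intros)

lemma mspan_sum:
  assumes "\<And>i. i \<in> I \<Longrightarrow> mspan e S m (\<Phi> i)"
  shows "mspan e S m (\<lambda>b. \<Sum>i\<in>I. \<Phi> i b)"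
  using assms by (induction I rule: infinite_finite_induct) (auto intro: mspan.intros)

lemma mspan_mult:
  assumes "mspan e S m \<Phi>" "finite S" "k \<notin> S" "0 < deg p"
  shows "mspan e (insert k S) (deg p + m) (\<lambda>b. u p (b k) * \<Phi> b)"
  using assms(1)
proof (induction rule: mspan.induct)
  case mspan_zero
  then show ?case
    by (simp add: mspan.mspan_zero)
next
  case (mspan_monomial f q)
  have "(\<Sum>i\<in>S. deg ((f(k := p)) i)) = (\<Sum>i\<in>S. deg (f i))"
    using assms by (intro sum.cong) auto
  then have "mspan e (insert k S) (deg p + m) (\<lambda>b. monomial e (f(k := p)) (insert k S) q b)"
    using mspan_monomial assms by (intro mspan.mspan_monomial) auto
  then show ?case
    using assms by (simp add: mult_monomial)
next
  case (mspan_add \<Phi> \<Psi>)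
  then show ?case
    by (simp add: distrib_left mspan.mspan_add)
next
  case (mspan_scale \<Phi> c)
  then show ?case
    by (simp add: mult_scale_right mspan.mspan_scale)
qed

text \<open>By the Leibniz rule one factor at a time is differentiated, which raises its order by
  one or rescales it; no exponent becomes zero. The data \<open>p'\<close> and \<open>c\<close> let
  one argument serve both D and W.\<close>

lemma mspan_derivation_monomial:
  assumes mult: "\<And>x y. \<delta> (x * y) = \<delta> x * y + x * \<delta> y"
    and u: "\<And>p x. \<delta> (u p x) = u (p' p) x + scaleA (c p) (u p x)"
    and p': "\<And>p. deg (p' p) = Suc (deg p)"
    and "finite S" "\<And>i. i \<in> S \<Longrightarrow> 0 < deg (f i)" "0 < deg q"
  shows "mspan e S (Suc ((\<Sum>i\<in>S. deg (f i)) + deg q)) (\<lambda>b. \<delta> (monomial e f S q b))"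
  using assms(4,5)
proof (induction S rule: finite_induct)
  case empty
  have "mspan e {} (Suc (deg q)) (\<lambda>b. monomial e f {} (p' q) b + scaleA (c q) (monomial e f {} q b))"
    using \<open>0 < deg q\<close> by (intro mspan.intros) (auto simp: p')
  then show ?case
    by (simp add: monomial_empty u)
next
  case (insert k S)
  let ?s = "(\<Sum>i\<in>S. deg (f i)) + deg q"
  have M: "mspan e S ?s (\<lambda>b. monomial e f S q b)"
    using insert.prems \<open>0 < deg q\<close> by (intro mspan_monomial) auto
  have "mspan e (insert k S) (deg (p' (f k)) + ?s) (\<lambda>b. u (p' (f k)) (b k) * monomial e f S q b)"
    using insert by (intro mspan_mult M) (auto simp: p')
  moreover have "mspan e (insert k S) (deg (f k) + ?s) (\<lambda>b. u (f k) (b k) * monomial e f S q b)"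
    using insert by (intro mspan_mult M) auto
  then have "mspan e (insert k S) (Suc (deg (f k)) + ?s)
      (\<lambda>b. u (f k) (b k) * monomial e f S q b)"
    by (rule mspan_le) simp
  moreover have "mspan e (insert k S) (deg (f k) + Suc ?s)
      (\<lambda>b. u (f k) (b k) * \<delta> (monomial e f S q b))"
    using insert by (intro mspan_mult insert.IH) auto
  ultimately have "mspan e (insert k S) (Suc (deg (f k) + ?s))
      (\<lambda>b. u (p' (f k)) (b k) * monomial e f S q b
        + scaleA (c (f k)) (u (f k) (b k) * monomial e f S q b)
        + u (f k) (b k) * \<delta> (monomial e f S q b))"
    by (intro mspan_add mspan_scale) (simp_all add: p')
  then show ?case
    using insert by (simp add: monomial_insert mult u distrib_right mult_scale_left add.assoc)
qed

lemma mspan_derivation: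
  assumes "mspan e S m \<Phi>" "finite S" and lin: "Vector_Spaces.linear scaleA scaleA \<delta>"
    and mult: "\<And>x y. \<delta> (x * y) = \<delta> x * y + x * \<delta> y"
    and u: "\<And>p x. \<delta> (u p x) = u (p' p) x + scaleA (c p) (u p x)"
    and p': "\<And>p. deg (p' p) = Suc (deg p)"
  shows "mspan e S (Suc m) (\<lambda>b. \<delta> (\<Phi> b))"
  using assms(1)
proof (induction rule: mspan.induct)
  interpret \<delta>: Vector_Spaces.linear scaleA scaleA \<delta>
    by fact
  {
    case mspan_zero
    then show ?case
      by (simp add: \<delta>.zero mspan.mspan_zero)
  next
    case (mspan_monomial f q)
    then show ?case
      using mspan_le[OF mspan_derivation_monomial[of \<delta> p' c S f q e, OF mult u p' \<open>finite S\<close>]]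
      by auto
  next
    case (mspan_add \<Phi> \<Psi>)
    then show ?case
      by (simp add: \<delta>.add mspan.mspan_add)
  next
    case (mspan_scale \<Phi> c)
    then show ?case
      by (simp add: \<delta>.scale mspan.mspan_scale)
  }
qed

lemma mspan_D: "mspan e S m \<Phi> \<Longrightarrow> finite S \<Longrightarrow> mspan e S (Suc m) (\<lambda>b. D (\<Phi> b))"
  by (rule mspan_derivation[where p' = "\<lambda>p. (Suc (fst p), snd p)" and c = "\<lambda>_. 0"])
    (auto simp: linear_D D_mult D_u deg_def)

lemma mspan_W: "mspan e S m \<Phi> \<Longrightarrow> finite S \<Longrightarrow> mspan e S (Suc m) (\<lambda>b. W (\<Phi> b))"
  by (rule mspan_derivation[where p' = "\<lambda>p. (fst p, Suc (snd p))" and c = "\<lambda>p. 2 * of_nat (fst p)"])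
    (auto simp: linear_W W_mult W_u deg_def)

lemma mspan_u:
  assumes "mspan e S m \<Phi>" "finite S"
  shows "mspan e S (deg p + m) (\<lambda>b. u p (\<Phi> b))"
proof -
  have W: "mspan e S (j + m) (\<lambda>b. (W ^^ j) (\<Phi> b))" for j
    by (induction j) (auto simp: assms intro: mspan_W)
  have "mspan e S (i + (j + m)) (\<lambda>b. (D ^^ i) ((W ^^ j) (\<Phi> b)))" for i j
    by (induction i) (auto simp: assms W intro: mspan_D)
  then show ?thesis
    by (simp add: u_def deg_def add.assoc)
qed

section \<open>Alternating sums\<close>

text \<open>Composing with the transposition of \<open>i\<close> and \<open>j\<close> flips the sign
  and fixes the monomial, so the sum equals its own negative.\<close>

lemma sum_sign_monomial:
  assumes S: "finite S" "e \<notin> S" and ij: "i \<in> S" "j \<in> S" "i \<noteq> j" "f i = f j"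
  shows "(\<Sum>\<sigma> | \<sigma> permutes S. scaleA (of_int (sign \<sigma>)) (monomial e f S q (a \<circ> \<sigma>))) = 0"
    (is "?s = 0")
proof -
  let ?t = "transpose i j"
  have t: "?t permutes S"
    using ij by (simp add: permutes_swap_id)
  have "?s = (\<Sum>\<sigma> | \<sigma> permutes S. scaleA (of_int (sign (\<sigma> \<circ> ?t))) (monomial e f S q (a \<circ> (\<sigma> \<circ> ?t))))"
    by (rule sum_permutations_compose_right[OF t])
  also have "\<dots> = (\<Sum>\<sigma> | \<sigma> permutes S. - scaleA (of_int (sign \<sigma>)) (monomial e f S q (a \<circ> \<sigma>)))"
  proof (rule sum.cong)
    fix \<sigma> assume "\<sigma> \<in> {\<sigma>. \<sigma> permutes S}"
    then have "permutation \<sigma>" "permutation ?t"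
      using S t by (auto simp: permutation_permutes)
    then have "sign (\<sigma> \<circ> ?t) = - sign \<sigma>"
      using ij by (simp add: sign_compose sign_swap_id)
    moreover have "monomial e f S q (a \<circ> (\<sigma> \<circ> ?t)) = monomial e f S q (a \<circ> \<sigma>)"
      using monomial_transpose[of i S j e f q "a \<circ> \<sigma>"] S ij by (simp add: comp_assoc)
    ultimately show "scaleA (of_int (sign (\<sigma> \<circ> ?t))) (monomial e f S q (a \<circ> (\<sigma> \<circ> ?t))) =
        - scaleA (of_int (sign \<sigma>)) (monomial e f S q (a \<circ> \<sigma>))"
      by simp
  qed simp
  also have "\<dots> = - ?s"
    by (simp add: sum_negf)
  \<comment> \<open>In characteristic zero the scalar 2 can be cancelled.\<close>
  finally have "scaleA 2 ?s = 0"
    using scale_left_distrib[of 1 1 ?s] by (simp add: eq_neg_iff_add_eq_0)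
  then show ?thesis
    by simp
qed

text \<open>By linearity it suffices to treat monomials. Were \<open>f\<close> injective on
  \<open>S\<close>, its values would already use up the whole order \<open>m\<close>, contradicting
  \<open>0 < deg q\<close>.\<close>

lemma sum_sign_mspan:
  assumes "mspan e S m \<Phi>" and S: "finite S" "e \<notin> S"
    and card: "2 * card S + 4 = 9 * n * (n + 1)" and m: "m \<le> 2 * n * card S"
  shows "(\<Sum>\<sigma> | \<sigma> permutes S. scaleA (of_int (sign \<sigma>)) (\<Phi> (a \<circ> \<sigma>))) = 0"
  using assms(1)
proof (induction rule: mspan.induct)
  case mspan_zero
  then show ?case
    by simp
next
  case (mspan_monomial f q)
  have "\<not> inj_on f S"
  proof
    assume inj: "inj_on f S"
    then have "2 * n * card S \<le> (\<Sum>i\<in>S. deg (f i))"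
      using sum_deg_ge[of "f ` S" n] S card mspan_monomial(1)
      by (fastforce simp: card_image sum.reindex comp_def)
    then show False
      using mspan_monomial m by linarith
  qed
  then obtain i j where "i \<in> S" "j \<in> S" "i \<noteq> j" "f i = f j"
    by (auto simp: inj_on_def)
  then show ?case
    using S by (intro sum_sign_monomial[of S e i j]) auto
next
  case (mspan_add \<Phi> \<Psi>)
  then show ?case
    by (simp add: scale_right_distrib sum.distrib)
next
  case (mspan_scale \<Phi> c)
  then show ?case
    by (simp add: scale_left_commute[of _ c] scale_sum_right[symmetric] del: scale_scale)
qed

section \<open>Brackets given by differential operators\<close>

text \<open>Bidifferential operators of order at most n in each argument, with no term that leaves
  an argument undifferentiated.\<close>

definition diff_bracket :: "nat \<Rightarrow> ('a \<Rightarrow> 'a \<Rightarrow> 'a) \<Rightarrow> bool" where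
  "diff_bracket n br \<longleftrightarrow> (\<exists>c. \<forall>x y. br x y =
    (\<Sum>p | 0 < deg p \<and> deg p \<le> n. \<Sum>q | 0 < deg q \<and> deg q \<le> n. scaleA (c p q) (u p x * u q y)))"

text \<open>Reduces right standard polynomials to left ones.\<close>

lemma diff_bracket_flip:
  assumes "diff_bracket n br"
  shows "diff_bracket n (\<lambda>x y. br y x)"
proof -
  obtain c where c: "\<And>x y. br x y = (\<Sum>p | 0 < deg p \<and> deg p \<le> n. \<Sum>q | 0 < deg q \<and> deg q \<le> n.
      scaleA (c p q) (u p x * u q y))"
    using assms unfolding diff_bracket_def by blast
  show ?thesis
    unfolding diff_bracket_def
    by (rule exI[of _ "\<lambda>p q. c q p"], subst sum.swap) (simp add: c mult.commute)
qed

text \<open>Every bracket adds at most 2n to the order: n on its outer argument and n on the inner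
  iterated bracket. The list must be nonempty, since \<open>b e\<close> alone carries the zero
  exponent.\<close>

lemma mspan_foldr_bracket:
  assumes br: "diff_bracket n br" and "l \<noteq> []" "distinct l" "e \<notin> set l"
  shows "mspan e (set l) (2 * n * length l) (\<lambda>b. foldr (\<lambda>i x. br (b i) x) l (b e))"
  using assms(2-)
proof (induction l)
  case Nil
  then show ?case
    by simp
next
  case (Cons k l)
  obtain c where c: "\<And>x y. br x y = (\<Sum>p | 0 < deg p \<and> deg p \<le> n. \<Sum>q | 0 < deg q \<and> deg q \<le> n.
      scaleA (c p q) (u p x * u q y))"
    using br unfolding diff_bracket_def by blast
  let ?\<Phi> = "\<lambda>b. foldr (\<lambda>i x. br (b i) x) l (b e)"
  have "mspan e (set l) (n + 2 * n * length l) (\<lambda>b. u q (?\<Phi> b))" if q: "0 < deg q" "deg q \<le> n" for q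
  proof (cases "l = []")
    case True
    \<comment> \<open>In the innermost bracket the inner argument is \<open>b e\<close> itself; the
      exponent function on the empty set is arbitrary.\<close>
    have "mspan e {} n (\<lambda>b. monomial e (\<lambda>_. (0, 0)) {} q b)"
      using q by (intro mspan_monomial) auto
    then show ?thesis
      using True by (simp add: monomial_empty)
  next
    case False
    then show ?thesis
      using mspan_le[OF mspan_u[OF Cons.IH]] q Cons.prems by auto
  qed
  then have "mspan e (insert k (set l)) (2 * n * length (k # l)) (\<lambda>b. u p (b k) * u q (?\<Phi> b))"
    if "0 < deg p" "deg p \<le> n" "0 < deg q" "deg q \<le> n" for p q
    using that Cons.prems
    by (intro mspan_le[OF mspan_mult[where m = "n + 2 * n * length l"]]) auto
  then show ?case
    by (auto simp: c intro!: mspan_sum mspan_scale)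
qed

lemma std_left_diff_bracket:
  assumes br: "diff_bracket n br" and d: "2 * (d - 1) + 4 = 9 * n * (n + 1)" "1 < d"
  shows "std_left scaleA br d a = 0"
proof -
  have "mspan d (set [1..<d]) (2 * n * length [1..<d])
      (\<lambda>b. foldr (\<lambda>i x. br (b i) x) [1..<d] (b d))"
    using d by (intro mspan_foldr_bracket[OF br]) auto
  moreover have S: "set [1..<d] = {1..d - 1}"
    using d by auto
  ultimately have "mspan d {1..d - 1} (2 * n * (d - 1))
      (\<lambda>b. foldr (\<lambda>i x. br (b i) x) [1..<d] (b d))"
    by simp
  then have "(\<Sum>\<sigma> | \<sigma> permutes {1..d - 1}. scaleA (of_int (sign \<sigma>))
      (foldr (\<lambda>i x. br ((a \<circ> \<sigma>) i) x) [1..<d] ((a \<circ> \<sigma>) d))) = 0"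
    using d by (intro sum_sign_mspan[where n = n and e = d]) auto
  \<comment> \<open>Permutations of {1..d-1} fix d, so the innermost argument may be permuted
    along.\<close>
  moreover have "std_left scaleA br d a = (\<Sum>\<sigma> | \<sigma> permutes {1..d - 1}. scaleA (of_int (sign \<sigma>))
      (foldr (\<lambda>i x. br ((a \<circ> \<sigma>) i) x) [1..<d] ((a \<circ> \<sigma>) d)))"
    unfolding std_left_def
  proof (rule sum.cong)
    fix \<sigma> assume "\<sigma> \<in> {\<sigma>. \<sigma> permutes {1..d - 1}}"
    then have "\<sigma> d = d"
      using d by (intro permutes_not_in[of \<sigma>]) auto
    then show "scaleA (of_int (sign \<sigma>)) (foldr (\<lambda>i x. br (a (\<sigma> i)) x) [1..<d] (a d)) =
        scaleA (of_int (sign \<sigma>)) (foldr (\<lambda>i x. br ((a \<circ> \<sigma>) i) x) [1..<d] ((a \<circ> \<sigma>) d))"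
      by simp
  qed simp
  ultimately show ?thesis
    by simp
qed

section \<open>The Rankin--Cohen bracket\<close>

text \<open>The terms are multiples of D^r W^j with j at most s, hence of order at most n. Order
  zero occurs only for r = 0, where s = n and the coefficient is binom(n-1, n) = 0.\<close>

lemma D_power_binom_expansion:
  assumes "r + s = n" "1 \<le> n"
  shows "\<exists>c. \<forall>x. (D ^^ r) (poly_op scaleA (binom_poly s) (shift_op scaleA W n) x) =
    (\<Sum>p | 0 < deg p \<and> deg p \<le> n. scaleA (c p) (u p x))"
proof -
  let ?P = "{p. 0 < deg p \<and> deg p \<le> n}"
  let ?p = "pcompose (binom_poly s) [:of_nat n - 1, 1 :: 'k:]"
  have [simp]: "finite ?P"
    using finite_deg_le[of n] by (rule finite_subset[rotated]) auto
  have deg: "degree ?p \<le> s"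
    using degree_binom_poly[of s, where 'a = 'k] degree_pcompose_le[of "binom_poly s" "[:of_nat n - 1, 1 :: 'k:]"]
    by simp
  have D_scale: "(D ^^ r) (scaleA c x) = scaleA c ((D ^^ r) x)" for c x
    by (induction r) (auto simp: D.scale)
  have D_add: "(D ^^ r) (x + y) = (D ^^ r) x + (D ^^ r) y" for x y
    by (induction r) (auto simp: D.add)
  have D_zero: "(D ^^ r) 0 = 0"
    by (induction r) (auto simp: D.zero)
  have D_sum: "(D ^^ r) (\<Sum>i\<in>I. g i) = (\<Sum>i\<in>I. (D ^^ r) (g i))" for g and I :: "nat set"
    by (induction I rule: infinite_finite_induct) (auto simp: D_add D_zero)
  have const: "coeff ?p 0 = 0" if "r = 0"
  proof -
    have "coeff ?p 0 = (of_nat n - 1) gchoose s"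
      by (simp add: poly_0_coeff_0[symmetric] poly_pcompose poly_binom_poly)
    also have "\<dots> = of_nat ((n - 1) choose s)"
      using \<open>1 \<le> n\<close> by (simp add: binomial_gbinomial of_nat_diff)
    also have "\<dots> = 0"
      using that assms by simp
    finally show ?thesis .
  qed
  define c where "c p = (if fst p = r then coeff ?p (snd p) else 0)" for p
  have "(D ^^ r) (poly_op scaleA (binom_poly s) (shift_op scaleA W n) x) =
    (\<Sum>p\<in>?P. scaleA (c p) (u p x))" for x
  proof -
    have "(D ^^ r) (poly_op scaleA (binom_poly s) (shift_op scaleA W n) x) =
        (\<Sum>j\<le>s. scaleA (c (r, j)) (u (r, j) x))"
      by (simp add: poly_op_shift_op[OF linear_W] poly_op_eq_sum[OF deg] D_sum D_scale u_def c_def)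
    also have "\<dots> = (\<Sum>p \<in> Pair r ` {..s}. scaleA (c p) (u p x))"
      by (simp add: sum.reindex inj_on_def)
    \<comment> \<open>Only (0, 0) can be lost here, and its coefficient vanishes by
      \<open>const\<close>.\<close>
    also have "\<dots> = (\<Sum>p \<in> ?P \<inter> Pair r ` {..s}. scaleA (c p) (u p x))"
    proof (intro sum.mono_neutral_right ballI)
      fix p assume "p \<in> Pair r ` {..s} - ?P \<inter> Pair r ` {..s}"
      then have "p = (0, 0)" "r = 0"
        using assms by (auto simp: deg_def)
      then show "scaleA (c p) (u p x) = 0"
        using const by (simp only: c_def fst_conv snd_conv if_cancel simp_thms scale_zero_left)
    qed auto
    also have "\<dots> = (\<Sum>p \<in> ?P. scaleA (c p) (u p x))"
    proof (intro sum.mono_neutral_left ballI)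
      fix p assume "p \<in> ?P - ?P \<inter> Pair r ` {..s}"
      then have "fst p \<noteq> r"
        using assms by (cases p) (auto simp: deg_def)
      then show "scaleA (c p) (u p x) = 0"
        by (simp add: c_def)
    qed auto
    finally show ?thesis .
  qed
  then show ?thesis
    by blast
qed

lemma diff_bracket_rc_bracket:
  assumes "1 \<le> n"
  shows "diff_bracket n (rc_bracket scaleA W D n)"
proof -
  let ?P = "{p. 0 < deg p \<and> deg p \<le> n}"
  let ?Q = "\<lambda>r s x. (D ^^ r) (poly_op scaleA (binom_poly s) (shift_op scaleA W n) x)"
  have "\<forall>r\<in>{..n}. \<exists>c. \<forall>x. ?Q r (n - r) x = (\<Sum>p\<in>?P. scaleA (c p) (u p x))"
    using D_power_binom_expansion[OF _ assms] by simp
  \<comment> \<open>One family serves both factors: for r + s = n the second factor is the member of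
    index s, because n - s = r.\<close>
  from bchoice[OF this] obtain c
    where c: "\<forall>r\<in>{..n}. \<forall>x. ?Q r (n - r) x = (\<Sum>p\<in>?P. scaleA (c r p) (u p x))"
    by (rule exE)
  define C where "C p q = (\<Sum>(r, s) \<in> {(r, s). r + s = n}. (-1) ^ r * (c r p * c s q))" for p q
  have "rc_bracket scaleA W D n x y = (\<Sum>p\<in>?P. \<Sum>q\<in>?P. scaleA (C p q) (u p x * u q y))" for x y
  proof -
    have "scaleA ((-1) ^ r) (?Q r s x * ?Q s r y) =
        (\<Sum>p\<in>?P. \<Sum>q\<in>?P. scaleA ((-1) ^ r * (c r p * c s q)) (u p x * u q y))"
      if "r + s = n" for r s
    proof -
      have r: "?Q r s x = (\<Sum>p\<in>?P. scaleA (c r p) (u p x))"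
        using c[rule_format, of r x] that by auto
      have s: "?Q s r y = (\<Sum>p\<in>?P. scaleA (c s p) (u p y))"
        using c[rule_format, of s y] that by auto
      show ?thesis
        unfolding r s sum_product scale_sum_right
          by (simp add: mult_scale_left mult_scale_right mult.commute[of "c s _"])
    qed
    then have "rc_bracket scaleA W D n x y = (\<Sum>(r, s) \<in> {(r, s). r + s = n}.
        \<Sum>p\<in>?P. \<Sum>q\<in>?P. scaleA ((-1) ^ r * (c r p * c s q)) (u p x * u q y))"
      unfolding rc_bracket_def by (intro sum.cong) auto
    also have "\<dots> = (\<Sum>p\<in>?P. \<Sum>q\<in>?P. \<Sum>(r, s) \<in> {(r, s). r + s = n}.
        scaleA ((-1) ^ r * (c r p * c s q)) (u p x * u q y))"
      unfolding case_prod_beta by (subst sum.swap, intro sum.cong refl sum.swap)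
    also have "\<dots> = (\<Sum>p\<in>?P. \<Sum>q\<in>?P. scaleA (C p q) (u p x * u q y))"
      by (simp add: C_def scale_sum_left case_prod_beta)
    finally show ?thesis .
  qed
  then show ?thesis
    unfolding diff_bracket_def by blast
qed

end

theorem corollary4:
  fixes scaleL :: "'k::field_char_0 \<Rightarrow> 'l::ab_group_add \<Rightarrow> 'l"
    and lbr :: "'l \<Rightarrow> 'l \<Rightarrow> 'l"
    and W D :: 'l
    and scaleA :: "'k \<Rightarrow> 'a::comm_ring \<Rightarrow> 'a"
    and act :: "'l \<Rightarrow> 'a \<Rightarrow> 'a"
    and n d :: nat
    and a :: "nat \<Rightarrow> 'a"
  assumes "two_dim_lie_algebra scaleL lbr W D"
    and "lie_module_algebra scaleL lbr scaleA act"
    and "n \<ge> 1"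
    and "d = 9 * n * (n + 1) div 2 - 1"
  shows "std_left scaleA (rc_bracket scaleA (act W) (act D) n) d a = 0 \<and>
         std_right scaleA (rc_bracket scaleA (act W) (act D) n) d a = 0"
proof -
  interpret L: two_dim_lie_algebra scaleL lbr W D
    by fact
  interpret A: lie_module_algebra scaleL lbr scaleA act
    by fact
  have "act W (act D x) = act D (act W x) + scaleA 2 (act D x)" for x
  proof -
    interpret l: Vector_Spaces.linear scaleL scaleA "\<lambda>y. act y x"
      by (rule A.act_linear_left)
    show ?thesis
      using A.act_lbr[of W D x] by (simp add: L.lbr_W_D l.scale algebra_simps)
  qed
  then interpret rc: rc_algebra scaleA "act W" "act D"
    by (intro rc_algebra.intro rc_algebra_axioms.intro A.A.comm_assoc_algebra_axioms
        A.act_linear A.act_derivation)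
  have "even (9 * n * (n + 1))"
    by simp
  then obtain k where k: "9 * n * (n + 1) = 2 * k"
    by (rule evenE)
  \<comment> \<open>The product is at least 18, so the truncated subtractions in d and d - 1 are
    genuine; its evenness makes the division exact.\<close>
  have "9 * 1 * (1 + 1) \<le> 9 * n * (n + 1)"
    using \<open>n \<ge> 1\<close> by (intro mult_le_mono) auto
  then have d: "2 * (d - 1) + 4 = 9 * n * (n + 1)" "1 < d"
    unfolding assms(4) k by auto
  have br: "rc.diff_bracket n (rc_bracket scaleA (act W) (act D) n)"
    using \<open>n \<ge> 1\<close> by (rule rc.diff_bracket_rc_bracket)
  \<comment> \<open>The right polynomial of a bracket is the left polynomial of the opposite
    bracket.\<close>
  have "std_right scaleA (rc_bracket scaleA (act W) (act D) n) d a =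
      std_left scaleA (\<lambda>x y. rc_bracket scaleA (act W) (act D) n y x) d a"
    by (simp add: std_right_def std_left_def)
  then show ?thesis
    using rc.std_left_diff_bracket[OF br d] rc.std_left_diff_bracket[OF rc.diff_bracket_flip[OF br] d]
    by simp
qed

end
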